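(* Let $\alpha$ be a continuous action of a countable sofic group $G$ on a compact metrizable space $X$ and let $\Sigma$ be a sofic approximation sequence of $G$. Assume that $h_\Sigma(X,G)\ne\pm\infty$. Let $\mu:\mathcal{B}(X)\to\mathbb{R}$ be a finite signed measure, where $\mathcal{B}(X)$ is the $\sigma$-algebra of Borel subsets of $X$. If $\int_X f\,d\mu\le P_\Sigma(f,X,G)$ for all real valued continuous functions $f$ on $X$, then $\mu\in M_G(X)$, i.e. $\mu$ is a $G$-invariant Borel probability measure on $X$.
   Context: **Signed measures.** A finite signed measure is a map $\mu:\mathcal{B}(X)\to\mathbb{R}$ with $\mu(\bigcup_{i=1}^\infty A_i)=\sum_{i=1}^\infty\mu(A_i)$ for every pairwise disjoint collection $\{A_i\}_{i=1}^\infty$ of members of $\mathcal{B}(X)$. $M_G(X)$ is the set of $G$-invariant Borel probability measures on $X$. **Sofic groups.** For $d\in\mathbb{N}$ write $[d]=\{1,\dots,d\}$ and $\mathrm{Sym}(d)$ for the permutation group of $[d]$. A sofic approximation sequence for a countable group $G$ is a sequence $\Sigma=\{\sigma_i:G\to\mathrm{Sym}(d_i)\}_{i\in\mathbb{N}}$ of maps (not necessarily homomorphisms; $d_i\in\mathbb{N}$; $\sigma_{i,s}=\sigma_i(s)$) such that (1) $\lim_{i}\frac{1}{d_i}|\{a\in[d_i]:\sigma_{i,s}\sigma_{i,t}(a)=\sigma_{i,st}(a)\}|=1$ for all $s,t\in G$; (2) $\lim_i\frac1{d_i}|\{a\in[d_i]:\sigma_{i,s}(a)\ne\sigma_{i,t}(a)\}|=1$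 for all distinct $s,t\in G$; (3) $\lim_i d_i=\infty$. $G$ is sofic if such a sequence exists. The action is written $\alpha_s(x)=sx$. **Sofic topological pressure and entropy.** Let $\rho$ be a compatible metric on $X$. For maps $\varphi,\psi:[d]\to X$ put $\rho_2(\varphi,\psi)=\big(\frac1d\sum_{a=1}^d\rho(\varphi(a),\psi(a))^2\big)^{1/2}$ and $\rho_\infty(\varphi,\psi)=\max_{1\le a\le d}\rho(\varphi(a),\psi(a))$. For a nonempty finite $F\subset G$, $\delta>0$ and $\sigma:G\to\mathrm{Sym}(d)$, let $\mathrm{Map}(\rho,F,\delta,\sigma)$ be the set of all $\varphi:[d]\to X$ with $\max_{s\in F}\rho_2(\alpha_s\circ\varphi,\varphi\circ\sigma_s)<\delta$. A subset $A$ of a (pseudo)metric space $(Y,d_Y)$ is $(d_Y,\varepsilon)$-separated if $d_Y(x,y)\ge\varepsilon$ for all distinct $x,y\in A$. For $\varepsilon>0$ let $$M^\varepsilon_{\Sigma,\infty}(f,X,G,\rho,F,\delta,\sigma)=\sup_{\mathcal{E}}\sum_{\varphi\in\mathcal{E}}\exp\Big(\sum_{a=1}^d f(\varphi(a))\Big),$$ with $\mathcal{E}$ running over the $(\rho_\infty,\varepsilon)$-separated subsets of $\mathrm{Map}(\rho,F,\delta,\sigma)$. Define $$P_{\Sigma,\infty}(f,X,G,\rho)=\sup_{\varepsilon>0}\ \inf_{F}\ \inf_{\delta>0}\ \limsup_{i\to\infty}\frac1{d_i}\log M^\varepsilon_{\Sigma,\infty}(f,X,G,\rho,F,\delta,\sigma_i)\in[-\infty,+\infty],$$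 $F$ running over nonempty finite subsets of $G$, with $\log 0=-\infty$ (so the limsup is $-\infty$ if $\mathrm{Map}(\rho,F,\delta,\sigma_i)=\emptyset$ for all large $i$). This value does not depend on the compatible metric $\rho$ and is denoted $P_\Sigma(f,X,G)$. The sofic topological entropy is $h_\Sigma(X,G)=P_\Sigma(0,X,G)$. *)

theory Defs
  imports
    "HOL-Probability.Probability"
    "HOL-Algebra.Group_Action"
    "HOL-Algebra.Sym_Groups"
begin

section \<open>Actions by homeomorphisms\<close>

text \<open>The acting group is discrete, so continuity of the action means continuity of every
  \<open>\<alpha> s\<close>. The values \<open>\<alpha> s\<close> are extensional functions on \<open>topspace X\<close>.\<close>

definition continuous_action ::
  "('g, 'm) monoid_scheme \<Rightarrow> 'a topology \<Rightarrow> ('g \<Rightarrow> 'a \<Rightarrow> 'a) \<Rightarrow> bool"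
  where "continuous_action G X \<alpha> \<longleftrightarrow>
    group_action G (topspace X) \<alpha> \<and> (\<forall>s\<in>carrier G. continuous_map X X (\<alpha> s))"

definition compatible_metric :: "'a topology \<Rightarrow> ('a \<Rightarrow> 'a \<Rightarrow> real) \<Rightarrow> bool"
  where "compatible_metric X \<rho> \<longleftrightarrow>
    Metric_space (topspace X) \<rho> \<and> Metric_space.mtopology (topspace X) \<rho> = X"


section \<open>Borel measures and signed measures\<close>

definition borel_space :: "'a topology \<Rightarrow> 'a measure"
  where "borel_space X = sigma (topspace X) {U. openin X U}"

text \<open>A signed measure is a set function of which only the values on Borel sets matter.\<close>

definition signed_measure :: "'a topology \<Rightarrow> ('a set \<Rightarrow> real) \<Rightarrow> bool"
  where "signed_measure X \<mu> \<longleftrightarrow>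
    (\<forall>A :: nat \<Rightarrow> 'a set. range A \<subseteq> sets (borel_space X) \<longrightarrow> disjoint_family A \<longrightarrow>
      (\<lambda>i. \<mu> (A i)) sums \<mu> (\<Union>i. A i))"

text \<open>The positive part of the Jordan decomposition, \<open>A \<mapsto> sup {\<mu> B | B \<subseteq> A Borel}\<close>; negative
  values are cut off by \<open>ennreal\<close>, which is harmless because \<open>B = {}\<close> contributes 0. The
  negative part of \<open>\<mu>\<close> is the positive part of \<open>- \<mu>\<close>.\<close>

definition positive_part :: "'a topology \<Rightarrow> ('a set \<Rightarrow> real) \<Rightarrow> 'a measure"
  where "positive_part X \<mu> =
    measure_of (topspace X) (sets (borel_space X))
      (\<lambda>A. SUP B \<in> {B \<in> sets (borel_space X). B \<subseteq> A}. ennreal (\<mu> B))"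

definition signed_integral :: "'a topology \<Rightarrow> ('a set \<Rightarrow> real) \<Rightarrow> ('a \<Rightarrow> real) \<Rightarrow> real"
  where "signed_integral X \<mu> f =
    (\<integral>x. f x \<partial>positive_part X \<mu>) - (\<integral>x. f x \<partial>positive_part X (\<lambda>A. - \<mu> A))"

definition invariant_measures ::
  "('g, 'm) monoid_scheme \<Rightarrow> 'a topology \<Rightarrow> ('g \<Rightarrow> 'a \<Rightarrow> 'a) \<Rightarrow> 'a measure set"
  where "invariant_measures G X \<alpha> =
    {M. prob_space M \<and> sets M = sets (borel_space X) \<and> (\<forall>s\<in>carrier G. distr M M (\<alpha> s) = M)}"


section \<open>Sofic approximation sequences\<close>

text \<open>The degrees \<open>d i\<close> may vanish for finitely many \<open>i\<close>, which affects none of the limits here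
  and below.\<close>

definition sofic_approximation ::
  "('g, 'm) monoid_scheme \<Rightarrow> (nat \<Rightarrow> nat) \<Rightarrow> (nat \<Rightarrow> 'g \<Rightarrow> nat \<Rightarrow> nat) \<Rightarrow> bool"
  where "sofic_approximation G d \<sigma> \<longleftrightarrow>
    (\<forall>i. \<sigma> i \<in> carrier G \<rightarrow> carrier (sym_group (d i))) \<and>
    (\<forall>s\<in>carrier G. \<forall>t\<in>carrier G.
      (\<lambda>i. real (card {a\<in>{1..d i}. \<sigma> i s (\<sigma> i t a) = \<sigma> i (s \<otimes>\<^bsub>G\<^esub> t) a}) / real (d i))
        \<longlonglongrightarrow> 1) \<and>
    (\<forall>s\<in>carrier G. \<forall>t\<in>carrier G. s \<noteq> t \<longrightarrow>
      (\<lambda>i. real (card {a\<in>{1..d i}. \<sigma> i s a \<noteq> \<sigma> i t a}) / real (d i)) \<longlonglongrightarrow> 1) \<and>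
    filterlim d at_top sequentially"


section \<open>Sofic topological pressure and entropy\<close>

definition rho_2 :: "('a \<Rightarrow> 'a \<Rightarrow> real) \<Rightarrow> nat \<Rightarrow> (nat \<Rightarrow> 'a) \<Rightarrow> (nat \<Rightarrow> 'a) \<Rightarrow> real"
  where "rho_2 \<rho> d \<phi> \<psi> = sqrt (1 / real d * (\<Sum>a=1..d. (\<rho> (\<phi> a) (\<psi> a))\<^sup>2))"

definition rho_inf :: "('a \<Rightarrow> 'a \<Rightarrow> real) \<Rightarrow> nat \<Rightarrow> (nat \<Rightarrow> 'a) \<Rightarrow> (nat \<Rightarrow> 'a) \<Rightarrow> real"
  where "rho_inf \<rho> d \<phi> \<psi> = (MAX a\<in>{1..d}. \<rho> (\<phi> a) (\<psi> a))"

text \<open>Maps \<open>[d] \<rightarrow> X\<close> are taken extensional, so that distinct elements of \<open>sofic_maps\<close> are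
  distinct as maps on \<open>{1..d}\<close>.\<close>

definition sofic_maps ::
  "'a topology \<Rightarrow> ('g \<Rightarrow> 'a \<Rightarrow> 'a) \<Rightarrow> ('a \<Rightarrow> 'a \<Rightarrow> real) \<Rightarrow> 'g set \<Rightarrow> real \<Rightarrow> nat \<Rightarrow>
    ('g \<Rightarrow> nat \<Rightarrow> nat) \<Rightarrow> (nat \<Rightarrow> 'a) set"
  where "sofic_maps X \<alpha> \<rho> F \<delta> d \<sigma> =
    {\<phi> \<in> {1..d} \<rightarrow>\<^sub>E topspace X. (MAX s\<in>F. rho_2 \<rho> d (\<alpha> s \<circ> \<phi>) (\<phi> \<circ> \<sigma> s)) < \<delta>}"

definition separated :: "('b \<Rightarrow> 'b \<Rightarrow> real) \<Rightarrow> real \<Rightarrow> 'b set \<Rightarrow> bool"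
  where "separated D \<epsilon> A \<longleftrightarrow> (\<forall>x\<in>A. \<forall>y\<in>A. x \<noteq> y \<longrightarrow> \<epsilon> \<le> D x y)"

text \<open>For compact \<open>X\<close> and \<open>\<epsilon> > 0\<close> all separated sets are finite, so the sum is never the
  default value 0 of an infinite sum.\<close>

definition sofic_partition_sum ::
  "('a \<Rightarrow> real) \<Rightarrow> 'a topology \<Rightarrow> ('g \<Rightarrow> 'a \<Rightarrow> 'a) \<Rightarrow> ('a \<Rightarrow> 'a \<Rightarrow> real) \<Rightarrow> real \<Rightarrow>
    'g set \<Rightarrow> real \<Rightarrow> nat \<Rightarrow> ('g \<Rightarrow> nat \<Rightarrow> nat) \<Rightarrow> ennreal"
  where "sofic_partition_sum f X \<alpha> \<rho> \<epsilon> F \<delta> d \<sigma> =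
    (SUP \<E> \<in> {\<E>. \<E> \<subseteq> sofic_maps X \<alpha> \<rho> F \<delta> d \<sigma> \<and> separated (rho_inf \<rho> d) \<epsilon> \<E>}.
      \<Sum>\<phi>\<in>\<E>. ennreal (exp (\<Sum>a=1..d. f (\<phi> a))))"

definition ln_extended :: "ennreal \<Rightarrow> ereal"
  where "ln_extended x =
    (if x = 0 then -\<infinity> else if x = \<infinity> then \<infinity> else ereal (ln (enn2real x)))"

definition sofic_pressure ::
  "('g, 'm) monoid_scheme \<Rightarrow> 'a topology \<Rightarrow> ('g \<Rightarrow> 'a \<Rightarrow> 'a) \<Rightarrow> ('a \<Rightarrow> 'a \<Rightarrow> real) \<Rightarrow>
    (nat \<Rightarrow> nat) \<Rightarrow> (nat \<Rightarrow> 'g \<Rightarrow> nat \<Rightarrow> nat) \<Rightarrow> ('a \<Rightarrow> real) \<Rightarrow> ereal"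
  where "sofic_pressure G X \<alpha> \<rho> d \<sigma> f =
    (SUP \<epsilon>\<in>{0<..}. INF F\<in>{F. F \<noteq> {} \<and> finite F \<and> F \<subseteq> carrier G}. INF \<delta>\<in>{0<..}.
      limsup (\<lambda>i. ereal (1 / real (d i)) *
        ln_extended (sofic_partition_sum f X \<alpha> \<rho> \<epsilon> F \<delta> (d i) (\<sigma> i))))"

definition sofic_entropy ::
  "('g, 'm) monoid_scheme \<Rightarrow> 'a topology \<Rightarrow> ('g \<Rightarrow> 'a \<Rightarrow> 'a) \<Rightarrow> ('a \<Rightarrow> 'a \<Rightarrow> real) \<Rightarrow>
    (nat \<Rightarrow> nat) \<Rightarrow> (nat \<Rightarrow> 'g \<Rightarrow> nat \<Rightarrow> nat) \<Rightarrow> ereal"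
  where "sofic_entropy G X \<alpha> \<rho> d \<sigma> = sofic_pressure G X \<alpha> \<rho> d \<sigma> (\<lambda>_. 0)"

end

theory Submission
  imports Defs
begin

text \<open>Write \<open>P f\<close> for the sofic pressure and \<open>h = P 0\<close> for the sofic entropy. Suppose that along
  all sufficiently good sofic maps \<open>\<phi>\<close> the averages \<open>(1/d) \<Sum>a f (\<phi> a)\<close> are at most \<open>c\<close> up to an
  arbitrarily small error. Then every partition sum of \<open>f\<close> is at most about \<open>exp (c d)\<close> times the
  one of the zero function, so \<open>P f \<le> h + c\<close>. This assumption on \<open>f\<close> and \<open>c\<close> is homogeneous,
  hence also \<open>P (t f) \<le> h + t c\<close> for all \<open>t > 0\<close>. If \<open>\<integral>f d\<mu> \<le> P f\<close> for all continuous \<open>f\<close>, then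
  \<open>t (\<integral>f d\<mu> - c) \<le> h\<close> for all \<open>t > 0\<close>, and as \<open>h\<close> is finite this forces \<open>\<integral>f d\<mu> \<le> c\<close>
  (lemma \<open>signed_integral_le\<close>).

  Three kinds of functions then suffice. Continuous \<open>f \<le> 0\<close> with \<open>c = 0\<close> show
  that nonnegative continuous functions have nonnegative integral; \<open>f = c = 1\<close> and
  \<open>f = c = -1\<close> show that \<open>\<mu>\<close> has total mass \<open>1\<close>; the coboundaries \<open>f x = g (s x) - g x\<close> with
  \<open>c = 0\<close> show that \<open>\<mu>\<close> is invariant. For a coboundary the
  assumption holds because \<open>\<sigma> s\<close> permutes \<open>[d]\<close>: the sum of \<open>g (s \<phi>(a)) - g (\<phi> a)\<close> equals that of
  \<open>g (s \<phi>(a)) - g (\<phi> (\<sigma> s a))\<close>, which is small as \<open>\<phi>\<close> is nearly equivariant and \<open>g\<close> is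
  uniformly continuous (lemma \<open>sofic_average_le_coboundary\<close>).

  It remains to pass from integrals of continuous functions to values on Borel sets. The Jordan
  decomposition writes \<open>\<mu>\<close> as a difference of two finite measures
  (lemma \<open>Jordan_decomposition\<close>), and two finite Borel measures on a compact metrizable space are
  compared by their integrals over continuous functions, by regularity and Urysohn's lemma
  (lemma \<open>measure_le_if_integral_continuous_le\<close>).\<close>

section \<open>Borel sets of a topological space\<close>

lemma sets_borel_space: "sets (borel_space X) = sigma_sets (topspace X) {U. openin X U}"
  unfolding borel_space_def by (rule sets_measure_of) (auto dest: openin_subset)

lemma space_borel_space: "space (borel_space X) = topspace X"
  unfolding borel_space_def by (rule space_measure_of) (auto dest: openin_subset)

lemma openin_sets_borel_space: "openin X U \<Longrightarrow> U \<in> sets (borel_space X)"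
  unfolding sets_borel_space by blast

lemma closedin_sets_borel_space: "closedin X C \<Longrightarrow> C \<in> sets (borel_space X)"
  by (metis closedin_def openin_sets_borel_space space_borel_space sets.Diff sets.top double_diff subset_refl)

lemma continuous_map_measurable_borel_space:
  assumes "continuous_map X Y f"
  shows "f \<in> borel_space X \<rightarrow>\<^sub>M borel_space Y"
  unfolding borel_space_def[of Y]
proof (rule measurable_sigma_sets)
  show "sets (sigma (topspace Y) {U. openin Y U}) = sigma_sets (topspace Y) {U. openin Y U}"
    using sets_borel_space[of Y] by (simp add: borel_space_def)
  show "{U. openin Y U} \<subseteq> Pow (topspace Y)"
    by (auto dest: openin_subset)
  show "f \<in> space (borel_space X) \<rightarrow> topspace Y"
    using assms by (auto simp: space_borel_space continuous_map_def)
  fix U assume "U \<in> {U. openin Y U}"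
  then have "openin X {x \<in> topspace X. f x \<in> U}"
    using assms by (auto simp: continuous_map_def)
  moreover have "f -` U \<inter> space (borel_space X) = {x \<in> topspace X. f x \<in> U}"
    by (auto simp: space_borel_space)
  ultimately show "f -` U \<inter> space (borel_space X) \<in> sets (borel_space X)"
    by (simp add: openin_sets_borel_space)
qed

lemma borel_space_euclidean: "borel_space euclidean = borel"
  by (simp add: borel_space_def borel_def)

section \<open>The Jordan decomposition of a signed measure\<close>

text \<open>The set function underlying \<open>positive_part\<close>. It is studied on its own because
  \<open>positive_part\<close> takes this value only once countable additivity is known.\<close>

definition upper_variation :: "'a topology \<Rightarrow> ('a set \<Rightarrow> real) \<Rightarrow> 'a set \<Rightarrow> ennreal"
  where "upper_variation X \<mu> A = (SUP B \<in> {B \<in> sets (borel_space X). B \<subseteq> A}. ennreal (\<mu> B))"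

lemma upper_variation_upper:
  "B \<in> sets (borel_space X) \<Longrightarrow> B \<subseteq> A \<Longrightarrow> ennreal (\<mu> B) \<le> upper_variation X \<mu> A"
  unfolding upper_variation_def by (rule SUP_upper) auto

lemma upper_variation_mono: "A \<subseteq> A' \<Longrightarrow> upper_variation X \<mu> A \<le> upper_variation X \<mu> A'"
  unfolding upper_variation_def by (rule SUP_subset_mono) auto

lemma signed_measure_sums:
  assumes "signed_measure X \<mu>" "\<And>i. A i \<in> sets (borel_space X)" "disjoint_family A"
  shows "(\<lambda>i::nat. \<mu> (A i)) sums \<mu> (\<Union>i. A i)"
  using assms unfolding signed_measure_def by blast

lemma signed_measure_empty:
  assumes "signed_measure X \<mu>"
  shows "\<mu> {} = 0"
proof -
  have "(\<lambda>i::nat. \<mu> {}) sums \<mu> (\<Union>i::nat. {})"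
    by (rule signed_measure_sums[OF assms]) (auto simp: disjoint_family_on_def)
  then show ?thesis
    by (simp add: sums_iff summable_const_iff)
qed

lemma signed_measure_Un:
  assumes \<mu>: "signed_measure X \<mu>"
    and AB: "A \<in> sets (borel_space X)" "B \<in> sets (borel_space X)" "A \<inter> B = {}"
  shows "\<mu> (A \<union> B) = \<mu> A + \<mu> B"
proof -
  have "(\<lambda>i. \<mu> (binaryset A B i)) sums \<mu> (\<Union>i. binaryset A B i)"
    using AB by (intro signed_measure_sums[OF \<mu>]) (auto simp: binaryset_def disjoint_family_on_def)
  moreover have "(\<lambda>i. \<mu> (binaryset A B i)) sums (\<mu> A + \<mu> B)"
    by (rule binaryset_sums) (rule signed_measure_empty[OF \<mu>])
  ultimately show ?thesis
    using sums_unique2 by (fastforce simp: UN_binaryset_eq)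
qed

lemma signed_measure_Diff:
  assumes \<mu>: "signed_measure X \<mu>"
    and AB: "A \<in> sets (borel_space X)" "B \<in> sets (borel_space X)" "B \<subseteq> A"
  shows "\<mu> (A - B) = \<mu> A - \<mu> B"
proof -
  have "\<mu> (B \<union> (A - B)) = \<mu> B + \<mu> (A - B)"
    using AB by (intro signed_measure_Un[OF \<mu>]) auto
  then show ?thesis
    using AB(3) by (simp add: Un_absorb1)
qed

lemma signed_measure_uminus: "signed_measure X \<mu> \<Longrightarrow> signed_measure X (\<lambda>A. - \<mu> A)"
  unfolding signed_measure_def by (auto intro: sums_minus)

text \<open>Near-optimal subsets \<open>B \<subseteq> A\<close> and \<open>B' \<subseteq> A'\<close> are disjoint, so \<open>\<mu> (B \<union> B') = \<mu> B + \<mu> B'\<close>. As the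
  truncation \<open>ennreal\<close> is additive only on nonnegative values, a subset of negative measure is
  dropped from the union.\<close>

lemma upper_variation_superadditive:
  assumes \<mu>: "signed_measure X \<mu>" and "A \<inter> A' = {}"
  shows "upper_variation X \<mu> A + upper_variation X \<mu> A' \<le> upper_variation X \<mu> (A \<union> A')"
proof -
  let ?S = "\<lambda>A. {B \<in> sets (borel_space X). B \<subseteq> A}"
  have ne: "?S A \<noteq> {}" for A
    by blast
  have "ennreal (\<mu> B) + ennreal (\<mu> B') \<le> upper_variation X \<mu> (A \<union> A')"
    if "B \<in> ?S A" "B' \<in> ?S A'" for B B'
  proof -
    have B: "B \<in> sets (borel_space X)" "B \<subseteq> A" and B': "B' \<in> sets (borel_space X)" "B' \<subseteq> A'"
      using that by auto
    consider "\<mu> B \<le> 0" | "\<mu> B' \<le> 0" | "\<mu> B \<ge> 0" "\<mu> B' \<ge> 0" by linarith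
    then show ?thesis
    proof cases
      case 1 then show ?thesis
        using upper_variation_upper[OF B'(1), of "A \<union> A'"] B' by (auto simp: ennreal_neg)
    next
      case 2 then show ?thesis
        using upper_variation_upper[OF B(1), of "A \<union> A'"] B by (auto simp: ennreal_neg)
    next
      case 3
      have "\<mu> (B \<union> B') = \<mu> B + \<mu> B'"
        using B B' assms(2) by (intro signed_measure_Un[OF \<mu>]) auto
      then have "ennreal (\<mu> B) + ennreal (\<mu> B') = ennreal (\<mu> (B \<union> B'))"
        using 3 by (simp add: ennreal_plus)
      also have "\<dots> \<le> upper_variation X \<mu> (A \<union> A')"
        using B B' by (intro upper_variation_upper) auto
      finally show ?thesis .
    qed
  qed
  then have "(SUP B' \<in> ?S A'. SUP B \<in> ?S A. ennreal (\<mu> B) + ennreal (\<mu> B'))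
      \<le> upper_variation X \<mu> (A \<union> A')"
    by (intro SUP_least)
  moreover have "(SUP B' \<in> ?S A'. SUP B \<in> ?S A. ennreal (\<mu> B) + ennreal (\<mu> B')) =
      upper_variation X \<mu> A + upper_variation X \<mu> A'"
    unfolding upper_variation_def
    by (simp only: ennreal_SUP_add_left[OF ne] ennreal_SUP_add_right[OF ne])
  ultimately show ?thesis by simp
qed

lemma ennreal_sum_le: "ennreal (\<Sum>i\<in>I. f i) \<le> (\<Sum>i\<in>I. ennreal (f i))"
proof (induction I rule: infinite_finite_induct)
  case (insert i I)
  have "ennreal (f i + s) \<le> ennreal (f i) + ennreal s" for s
    by (cases "0 \<le> f i"; cases "0 \<le> s")
      (auto simp: ennreal_plus ennreal_neg intro: ennreal_leI)
  then have "ennreal (f i + (\<Sum>i\<in>I. f i)) \<le> ennreal (f i) + ennreal (\<Sum>i\<in>I. f i)" .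
  also have "\<dots> \<le> ennreal (f i) + (\<Sum>i\<in>I. ennreal (f i))"
    by (intro add_left_mono insert)
  finally show ?case
    using insert by simp
qed auto

text \<open>Superadditivity bounds the partial sums from above. Conversely, a subset of the union is cut
  into its pieces \<open>B \<inter> A i\<close>, each of which is a competitor for \<open>A i\<close>.\<close>

lemma countably_additive_upper_variation:
  assumes \<mu>: "signed_measure X \<mu>"
  shows "countably_additive (sets (borel_space X)) (upper_variation X \<mu>)"
proof (rule countably_additiveI)
  fix A :: "nat \<Rightarrow> 'a set"
  assume "range A \<subseteq> sets (borel_space X)" and dis: "disjoint_family A"
  then have A: "\<And>i. A i \<in> sets (borel_space X)" by auto
  have "(\<Sum>i<n. upper_variation X \<mu> (A i)) \<le> upper_variation X \<mu> (\<Union>i<n. A i)" for n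
  proof (induction n)
    case (Suc n)
    have "A i \<inter> A n = {}" if "i < n" for i
      using dis that by (intro disjoint_family_onD[OF dis]) auto
    then have "(\<Union>i<n. A i) \<inter> A n = {}" by blast
    then have "upper_variation X \<mu> (\<Union>i<n. A i) + upper_variation X \<mu> (A n)
        \<le> upper_variation X \<mu> ((\<Union>i<n. A i) \<union> A n)"
      by (rule upper_variation_superadditive[OF \<mu>])
    also have "(\<Union>i<n. A i) \<union> A n = (\<Union>i<Suc n. A i)"
      by (auto simp: less_Suc_eq)
    finally show ?case
      unfolding sum.lessThan_Suc by (rule order_trans[OF add_right_mono[OF Suc]])
  qed simp
  moreover have "upper_variation X \<mu> (\<Union>i<n. A i) \<le> upper_variation X \<mu> (\<Union>i. A i)" for n
    by (intro upper_variation_mono) auto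
  ultimately have "(\<Sum>i. upper_variation X \<mu> (A i)) \<le> upper_variation X \<mu> (\<Union>i. A i)"
    unfolding suminf_eq_SUP by (intro SUP_least) (rule order_trans)
  moreover have "upper_variation X \<mu> (\<Union>i. A i) \<le> (\<Sum>i. upper_variation X \<mu> (A i))"
    unfolding upper_variation_def[of X \<mu> "\<Union>i. A i"]
  proof (rule SUP_least)
    fix B assume "B \<in> {B \<in> sets (borel_space X). B \<subseteq> (\<Union>i. A i)}"
    then have B: "B \<in> sets (borel_space X)" and "B \<subseteq> (\<Union>i. A i)" by auto
    then have B_eq: "(\<Union>i. B \<inter> A i) = B" by blast
    have "(\<lambda>i. \<mu> (B \<inter> A i)) sums \<mu> (\<Union>i. B \<inter> A i)"
      using A B dis by (intro signed_measure_sums[OF \<mu>]) (auto simp: disjoint_family_on_def)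
    then have "(\<lambda>n. ennreal (\<Sum>i<n. \<mu> (B \<inter> A i))) \<longlonglongrightarrow> ennreal (\<mu> B)"
      unfolding B_eq sums_def by (rule tendsto_ennrealI)
    moreover have "ennreal (\<Sum>i<n. \<mu> (B \<inter> A i)) \<le> (\<Sum>i. upper_variation X \<mu> (A i))" for n
    proof -
      have "ennreal (\<Sum>i<n. \<mu> (B \<inter> A i)) \<le> (\<Sum>i<n. ennreal (\<mu> (B \<inter> A i)))"
        by (rule ennreal_sum_le)
      also have "\<dots> \<le> (\<Sum>i<n. upper_variation X \<mu> (A i))"
        using A B by (intro sum_mono upper_variation_upper) auto
      also have "\<dots> \<le> (\<Sum>i. upper_variation X \<mu> (A i))"
        by (intro sum_le_suminf) auto
      finally show ?thesis .
    qed
    ultimately show "ennreal (\<mu> B) \<le> (\<Sum>i. upper_variation X \<mu> (A i))"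
      by (intro LIMSEQ_le_const2) auto
  qed
  ultimately show "(\<Sum>i. upper_variation X \<mu> (A i)) = upper_variation X \<mu> (\<Union>i. A i)"
    by (rule antisym)
qed

lemma positive_upper_variation:
  assumes "signed_measure X \<mu>"
  shows "positive (sets (borel_space X)) (upper_variation X \<mu>)"
proof -
  have "{B \<in> sets (borel_space X). B \<subseteq> {}} = {{}}" by auto
  then show ?thesis
    using signed_measure_empty[OF assms] by (simp add: positive_def upper_variation_def)
qed

lemma disjoint_family_decseq:
  assumes "decseq (E :: nat \<Rightarrow> 'a set)"
  shows "disjoint_family (\<lambda>n. E n - E (Suc n))"
proof -
  have "(E m - E (Suc m)) \<inter> (E n - E (Suc n)) = {}" if "m < n" for m n
    using decseqD[OF assms, of "Suc m" n] that by auto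
  then show ?thesis
    unfolding disjoint_family_on_def by (metis Int_commute nat_neq_iff)
qed

text \<open>A set \<open>E\<close> of infinite upper variation splits into two pieces of absolute measure at least \<open>1\<close>,
  by taking a subset \<open>B\<close> whose measure exceeds \<open>\<bar>\<mu> E\<bar> + 1\<close>. By additivity one of the pieces
  again has infinite upper variation. Iterating and discarding the other piece each time produces
  disjoint sets whose measures do not tend to \<open>0\<close>, against countable additivity of \<open>\<mu>\<close>.\<close>

lemma upper_variation_finite:
  assumes \<mu>: "signed_measure X \<mu>"
  shows "upper_variation X \<mu> (topspace X) \<noteq> \<infinity>"
proof
  let ?P = "\<lambda>(n::nat) E. E \<in> sets (borel_space X) \<and> upper_variation X \<mu> E = \<infinity>"
  assume inf: "upper_variation X \<mu> (topspace X) = \<infinity>"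
  have add: "additive (sets (borel_space X)) (upper_variation X \<mu>)"
    by (intro sets.countably_additive_additive countably_additive_upper_variation
        positive_upper_variation \<mu>)
  have "\<exists>E. \<forall>n. ?P n (E n) \<and> E (Suc n) \<subseteq> E n \<and> 1 \<le> \<bar>\<mu> (E n - E (Suc n))\<bar>"
  proof (rule dependent_nat_choice)
    show "\<exists>E. ?P 0 E"
      using inf sets.top[of "borel_space X"] by (auto simp: space_borel_space)
  next
    fix E n assume E: "?P n E"
    have "ennreal (\<bar>\<mu> E\<bar> + 1) < upper_variation X \<mu> E"
      using E by simp
    then obtain B where B: "B \<in> sets (borel_space X)" "B \<subseteq> E"
      and "ennreal (\<bar>\<mu> E\<bar> + 1) < ennreal (\<mu> B)"
      unfolding upper_variation_def less_SUP_iff by auto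
    then have big: "\<bar>\<mu> E\<bar> + 1 < \<mu> B"
      by (metis ennreal_leI not_le)
    have "upper_variation X \<mu> B + upper_variation X \<mu> (E - B) = upper_variation X \<mu> (B \<union> (E - B))"
      using E B by (intro additiveD[OF add, symmetric]) auto
    then have "upper_variation X \<mu> B + upper_variation X \<mu> (E - B) = \<infinity>"
      using E B by (simp add: Un_absorb1)
    then consider "upper_variation X \<mu> B = \<infinity>" | "upper_variation X \<mu> (E - B) = \<infinity>"
      by (auto simp: ennreal_add_eq_top)
    then show "\<exists>E'. ?P (Suc n) E' \<and> E' \<subseteq> E \<and> 1 \<le> \<bar>\<mu> (E - E')\<bar>"
    proof cases
      case 1
      have "1 \<le> \<bar>\<mu> (E - B)\<bar>"
        using big E B by (simp add: signed_measure_Diff[OF \<mu>])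
      with 1 B show ?thesis by blast
    next
      case 2
      have "E - (E - B) = B" using B by auto
      with 2 E B big show ?thesis
        by (intro exI[of _ "E - B"]) auto
    qed
  qed
  then obtain E where E: "\<And>n. E n \<in> sets (borel_space X)" "\<And>n. E (Suc n) \<subseteq> E n"
    and big: "\<And>n. 1 \<le> \<bar>\<mu> (E n - E (Suc n))\<bar>" by auto
  have "decseq E" using E by (simp add: decseq_Suc_iff)
  then have "disjoint_family (\<lambda>n. E n - E (Suc n))"
    by (rule disjoint_family_decseq)
  then have "(\<lambda>n. \<mu> (E n - E (Suc n))) sums \<mu> (\<Union>n. E n - E (Suc n))"
    using E by (intro signed_measure_sums[OF \<mu>]) auto
  then have "(\<lambda>n. \<mu> (E n - E (Suc n))) \<longlonglongrightarrow> 0"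
    using sums_summable summable_LIMSEQ_zero by blast
  then have "(\<lambda>n. \<bar>\<mu> (E n - E (Suc n))\<bar>) \<longlonglongrightarrow> 0"
    by (rule tendsto_rabs_zero)
  then have "\<forall>\<^sub>F n in sequentially. \<bar>\<mu> (E n - E (Suc n))\<bar> < 1"
    by (rule order_tendstoD) simp
  then obtain n where "\<bar>\<mu> (E n - E (Suc n))\<bar> < 1"
    using eventually_happens'[OF sequentially_bot] by blast
  then show False
    using big[of n] by simp
qed

lemma sets_positive_part [simp]: "sets (positive_part X \<mu>) = sets (borel_space X)"
  unfolding positive_part_def space_borel_space[symmetric] by (rule sets.sets_measure_of_eq)

lemma space_positive_part [simp]: "space (positive_part X \<mu>) = topspace X"
  by (simp add: sets_eq_imp_space_eq[OF sets_positive_part] space_borel_space)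

lemma emeasure_positive_part:
  assumes "signed_measure X \<mu>" "A \<in> sets (borel_space X)"
  shows "emeasure (positive_part X \<mu>) A = upper_variation X \<mu> A"
proof (rule emeasure_measure_of)
  show "positive_part X \<mu> =
      measure_of (topspace X) (sets (borel_space X)) (upper_variation X \<mu>)"
    unfolding positive_part_def upper_variation_def ..
  show "sets (borel_space X) \<subseteq> Pow (topspace X)"
    using sets.space_closed[of "borel_space X"] by (simp add: space_borel_space)
qed (use assms in \<open>simp_all add: positive_upper_variation countably_additive_upper_variation\<close>)

lemma finite_measure_positive_part:
  assumes "signed_measure X \<mu>"
  shows "finite_measure (positive_part X \<mu>)"
proof
  have "topspace X \<in> sets (borel_space X)"
    using sets.top[of "borel_space X"] by (simp add: space_borel_space)
  then show "emeasure (positive_part X \<mu>) (space (positive_part X \<mu>)) \<noteq> \<infinity>"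
    using upper_variation_finite[OF assms] by (simp add: emeasure_positive_part[OF assms])
qed

lemma measure_positive_part_le:
  assumes \<mu>: "signed_measure X \<mu>" and A: "A \<in> sets (borel_space X)"
    and le: "\<And>B. B \<in> sets (borel_space X) \<Longrightarrow> B \<subseteq> A \<Longrightarrow> \<mu> B \<le> c"
  shows "measure (positive_part X \<mu>) A \<le> c"
proof -
  interpret finite_measure "positive_part X \<mu>" by (rule finite_measure_positive_part[OF \<mu>])
  have "0 \<le> c" using le[of "{}"] signed_measure_empty[OF \<mu>] by simp
  have "ennreal (measure (positive_part X \<mu>) A) \<le> ennreal c"
    unfolding emeasure_eq_measure[symmetric] emeasure_positive_part[OF \<mu> A] upper_variation_def
    by (rule SUP_least) (auto intro!: ennreal_leI le)
  then show ?thesis using \<open>0 \<le> c\<close> by simp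
qed

lemma measure_positive_part_ge:
  assumes \<mu>: "signed_measure X \<mu>" and A: "A \<in> sets (borel_space X)"
  shows "\<mu> A \<le> measure (positive_part X \<mu>) A"
proof -
  interpret finite_measure "positive_part X \<mu>" by (rule finite_measure_positive_part[OF \<mu>])
  have "ennreal (\<mu> A) \<le> ennreal (measure (positive_part X \<mu>) A)"
    unfolding emeasure_eq_measure[symmetric] emeasure_positive_part[OF \<mu> A]
    using A by (intro upper_variation_upper) auto
  then show ?thesis by simp
qed

text \<open>For \<open>B \<subseteq> A\<close> we have \<open>\<mu> B = \<mu> A + (- \<mu>) (A - B)\<close>, and taking the
  supremum over \<open>B\<close> gives one inequality; the other is the same one for \<open>- \<mu>\<close>.\<close>

lemma Jordan_decomposition:
  assumes \<mu>: "signed_measure X \<mu>" and A: "A \<in> sets (borel_space X)"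
  shows "\<mu> A = measure (positive_part X \<mu>) A - measure (positive_part X (\<lambda>A. - \<mu> A)) A"
proof -
  have *: "measure (positive_part X \<nu>) A \<le> \<nu> A + measure (positive_part X (\<lambda>A. - \<nu> A)) A"
    if \<nu>: "signed_measure X \<nu>" for \<nu>
  proof (rule measure_positive_part_le[OF \<nu> A])
    fix B assume B: "B \<in> sets (borel_space X)" "B \<subseteq> A"
    interpret finite_measure "positive_part X (\<lambda>A. - \<nu> A)"
      by (rule finite_measure_positive_part[OF signed_measure_uminus[OF \<nu>]])
    have "- \<nu> (A - B) \<le> measure (positive_part X (\<lambda>A. - \<nu> A)) (A - B)"
      using A B by (intro measure_positive_part_ge signed_measure_uminus \<nu>) auto
    also have "\<dots> \<le> measure (positive_part X (\<lambda>A. - \<nu> A)) A"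
      using A by (intro finite_measure_mono) auto
    finally show "\<nu> B \<le> \<nu> A + measure (positive_part X (\<lambda>A. - \<nu> A)) A"
      using A B by (simp add: signed_measure_Diff[OF \<nu>])
  qed
  show ?thesis
    using *[OF \<mu>] *[OF signed_measure_uminus[OF \<mu>]] by simp
qed

section \<open>Comparing Borel measures by integrals of continuous functions\<close>

text \<open>The sets that can be approximated in this way form a \<open>\<sigma>\<close>-algebra. It contains the open sets,
  because in a metrizable space these are increasing unions of closed sets. Approximating from
  both sides at once makes the property stable under complements.\<close>

lemma closed_open_approximation:
  assumes M: "finite_measure M" and sets_M: "sets M = sets (borel_space X)"
    and X: "metrizable_space X"
    and A: "A \<in> sets M" and "0 < \<epsilon>"
  shows "\<exists>C U. closedin X C \<and> openin X U \<and> C \<subseteq> A \<and> A \<subseteq> U \<and> measure M (U - C) < \<epsilon>"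
proof -
  interpret finite_measure M by (rule M)
  have opn: "U \<in> sets M" if "openin X U" for U
    using that by (simp add: sets_M openin_sets_borel_space)
  have cls: "C \<in> sets M" if "closedin X C" for C
    using that by (simp add: sets_M closedin_sets_borel_space)
  have "A \<in> sigma_sets (topspace X) {U. openin X U}"
    using A by (simp add: sets_M sets_borel_space)
  then show ?thesis
    using \<open>0 < \<epsilon>\<close>
  proof (induction arbitrary: \<epsilon>)
    case (Basic U)
    then have "fsigma_in X U"
      using X by (simp add: open_imp_fsigma_in)
    then obtain C where C: "\<And>n. closedin X (C n)" "\<And>n. C n \<subseteq> C (Suc n)" "\<Union> (range C) = U"
      unfolding fsigma_in_ascending by auto
    have "(\<lambda>n. measure M (C n)) \<longlonglongrightarrow> measure M (\<Union>n. C n)"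
      using C by (intro finite_Lim_measure_incseq) (auto simp: incseq_Suc_iff cls)
    then have "\<forall>\<^sub>F n in sequentially. measure M U - \<epsilon> < measure M (C n)"
      unfolding C(3) using Basic.prems by (intro order_tendstoD(1)[of _ "measure M U"]) auto
    then obtain n where n: "measure M U - \<epsilon> < measure M (C n)"
      using eventually_happens'[OF sequentially_bot] by blast
    have "C n \<subseteq> U" using C(3) by blast
    moreover have "measure M (U - C n) = measure M U - measure M (C n)"
      using \<open>C n \<subseteq> U\<close> Basic.hyps C(1) by (intro finite_measure_Diff) (auto simp: opn cls)
    ultimately show ?case
      using n C(1) Basic.hyps by (intro exI[of _ "C n"] exI[of _ U]) auto
  next
    case Empty
    then show ?case by (intro exI[of _ "{}"]) auto
  next
    case (Compl A)
    obtain C U where CU: "closedin X C" "openin X U" "C \<subseteq> A" "A \<subseteq> U"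
      "measure M (U - C) < \<epsilon>" using Compl.IH[OF Compl.prems] by blast
    have "(topspace X - C) - (topspace X - U) = U - C"
      using openin_subset[OF CU(2)] by blast
    then have "measure M ((topspace X - C) - (topspace X - U)) < \<epsilon>"
      using CU(5) by simp
    moreover have "closedin X (topspace X - U)" "openin X (topspace X - C)"
      using CU by auto
    moreover have "topspace X - U \<subseteq> topspace X - A" "topspace X - A \<subseteq> topspace X - C"
      using CU by auto
    ultimately show ?case by blast
  next
    case (Union A)
    have "\<forall>i. \<exists>P. closedin X (fst P) \<and> openin X (snd P) \<and> fst P \<subseteq> A i \<and> A i \<subseteq> snd P \<and>
        measure M (snd P - fst P) < \<epsilon> / 2 * (1/2) ^ Suc i"
    proof
      fix i
      have "0 < \<epsilon> / 2 * (1/2) ^ Suc i" using Union.prems by simp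
      from Union.IH[OF this, of i] show "\<exists>P. closedin X (fst P) \<and> openin X (snd P) \<and>
          fst P \<subseteq> A i \<and> A i \<subseteq> snd P \<and> measure M (snd P - fst P) < \<epsilon> / 2 * (1/2) ^ Suc i"
        by simp
    qed
    then obtain P where P: "\<And>i. closedin X (fst (P i)) \<and> openin X (snd (P i)) \<and>
        fst (P i) \<subseteq> A i \<and> A i \<subseteq> snd (P i) \<and>
        measure M (snd (P i) - fst (P i)) < \<epsilon> / 2 * (1/2) ^ Suc i"
      using choice[of "\<lambda>i P. closedin X (fst P) \<and> openin X (snd P) \<and> fst P \<subseteq> A i \<and> A i \<subseteq> snd P \<and>
        measure M (snd P - fst P) < \<epsilon> / 2 * (1/2) ^ Suc i"] by blast
    define C U where "C = (\<lambda>i. fst (P i))" and "U = (\<lambda>i. snd (P i))"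
    have C: "\<And>i. closedin X (C i)" and U: "\<And>i. openin X (U i)"
      and CA: "\<And>i. C i \<subseteq> A i" and AU: "\<And>i. A i \<subseteq> U i"
      and small: "\<And>i. measure M (U i - C i) < \<epsilon> / 2 * (1/2) ^ Suc i"
      using P by (auto simp only: C_def U_def)
    have UC[measurable]: "\<And>i. U i \<in> sets M" "\<And>i. C i \<in> sets M"
      using U C by (auto intro: opn cls)
    \<comment> \<open>One half of \<open>\<epsilon>\<close> pays for the errors of all \<open>A i\<close>. The other half pays for
      truncating the union of the closed sets, which need not be closed, to a finite one.\<close>
    have sums: "(\<lambda>i. \<epsilon> / 2 * (1/2) ^ Suc i) sums (\<epsilon> / 2 * 1)"
      by (rule sums_mult) (rule power_half_series)
    have summ: "summable (\<lambda>i. measure M (U i - C i))"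
    proof (rule summable_comparison_test'[OF sums_summable[OF sums]])
      show "norm (measure M (U i - C i)) \<le> \<epsilon> / 2 * (1/2) ^ Suc i" if "0 \<le> i" for i
        using less_imp_le[OF small, of i] by simp
    qed
    have "measure M ((\<Union>i. U i) - (\<Union>i. C i)) \<le> measure M (\<Union>i. U i - C i)"
      by (intro finite_measure_mono) auto
    also have "\<dots> \<le> (\<Sum>i. measure M (U i - C i))"
      by (intro finite_measure_subadditive_countably summ) auto
    also have "\<dots> \<le> (\<Sum>i. \<epsilon> / 2 * (1/2) ^ Suc i)"
      by (intro suminf_le summ sums_summable[OF sums] less_imp_le[OF small])
    also have "\<dots> = \<epsilon> / 2"
      using sums_unique[OF sums] by simp
    finally have half: "measure M ((\<Union>i. U i) - (\<Union>i. C i)) \<le> \<epsilon> / 2" .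
    have "(\<lambda>n. measure M (\<Union>i\<le>n. C i)) \<longlonglongrightarrow> measure M (\<Union>n. \<Union>i\<le>n. C i)"
    proof (rule finite_Lim_measure_incseq)
      show "range (\<lambda>n. \<Union>i\<le>n. C i) \<subseteq> sets M" by auto
      show "incseq (\<lambda>n. \<Union>i\<le>n. C i)"
        unfolding incseq_def by (intro allI impI UN_mono) auto
    qed
    also have "(\<Union>n. \<Union>i\<le>n. C i) = (\<Union>i. C i)" by auto
    finally have "\<forall>\<^sub>F n in sequentially.
        measure M (\<Union>i. C i) - \<epsilon> / 2 < measure M (\<Union>i\<le>n. C i)"
      using Union.prems by (intro order_tendstoD(1)) auto
    then obtain n where n: "measure M (\<Union>i. C i) - \<epsilon> / 2 < measure M (\<Union>i\<le>n. C i)"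
      using eventually_happens'[OF sequentially_bot] by blast
    have CU: "(\<Union>i\<le>n. C i) \<subseteq> (\<Union>i. U i)" "(\<Union>i. C i) \<subseteq> (\<Union>i. U i)"
      using CA AU by blast+
    have "measure M ((\<Union>i. U i) - (\<Union>i\<le>n. C i)) = measure M (\<Union>i. U i) - measure M (\<Union>i\<le>n. C i)"
      by (intro finite_measure_Diff CU) auto
    moreover have "measure M ((\<Union>i. U i) - (\<Union>i. C i)) = measure M (\<Union>i. U i) - measure M (\<Union>i. C i)"
      by (intro finite_measure_Diff CU) auto
    ultimately have "measure M ((\<Union>i. U i) - (\<Union>i\<le>n. C i)) < \<epsilon>"
      using half n by linarith
    moreover have "closedin X (\<Union>i\<le>n. C i)" using C by (intro closedin_Union) auto
    moreover have "openin X (\<Union>i. U i)" using U by (intro openin_Union) auto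
    moreover have "(\<Union>i\<le>n. C i) \<subseteq> (\<Union>i. A i)" "(\<Union>i. A i) \<subseteq> (\<Union>i. U i)"
      using CA AU by blast+
    ultimately show ?case by blast
  qed
qed

lemma bounded_continuous_compact:
  assumes "compact_space X" "continuous_map X euclideanreal f"
  obtains B where "0 < B" "\<And>x. x \<in> topspace X \<Longrightarrow> \<bar>f x\<bar> \<le> B"
proof -
  have "compactin euclideanreal (f ` topspace X)"
    using assms unfolding compact_space_def by (rule image_compactin)
  then have "bounded (f ` topspace X)"
    by (simp add: compact_imp_bounded)
  then show thesis
    unfolding bounded_pos using that by auto
qed

lemma integrable_continuous_compact:
  assumes M: "finite_measure M" "sets M = sets (borel_space X)"
    and X: "compact_space X" and f: "continuous_map X euclideanreal f"
  shows "integrable M f"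
proof -
  interpret finite_measure M by fact
  obtain B where B: "\<And>x. x \<in> topspace X \<Longrightarrow> \<bar>f x\<bar> \<le> B"
    using bounded_continuous_compact[OF X f] by blast
  have "f \<in> borel_measurable M"
    using continuous_map_measurable_borel_space[OF f] M(2)
    by (simp add: borel_space_euclidean cong: measurable_cong_sets)
  moreover have "space M = topspace X"
    using sets_eq_imp_space_eq[OF M(2)] by (simp add: space_borel_space)
  ultimately show ?thesis
    using B by (intro integrable_const_bound[of _ B]) auto
qed

text \<open>Approximate \<open>A\<close> from inside by a closed \<open>C\<close> with respect to \<open>M\<close> and from outside by an open \<open>U\<close> with
  respect to \<open>N\<close>. A Urysohn function between \<open>C\<close> and the complement of \<open>U\<close> has \<open>M\<close>-integral at least
  \<open>M C\<close> and \<open>N\<close>-integral at most \<open>N U\<close>.\<close>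

lemma measure_le_if_integral_continuous_le:
  assumes M: "finite_measure M" "sets M = sets (borel_space X)"
    and N: "finite_measure N" "sets N = sets (borel_space X)"
    and X: "compact_space X" "metrizable_space X"
    and le: "\<And>f. continuous_map X euclideanreal f \<Longrightarrow> (\<And>x. x \<in> topspace X \<Longrightarrow> 0 \<le> f x) \<Longrightarrow>
      (\<integral>x. f x \<partial>M) \<le> (\<integral>x. f x \<partial>N)"
    and A: "A \<in> sets (borel_space X)"
  shows "measure M A \<le> measure N A"
proof (rule field_le_epsilon)
  fix \<epsilon> :: real assume "0 < \<epsilon>"
  then have "0 < \<epsilon> / 2" by simp
  interpret M: finite_measure M by fact
  interpret N: finite_measure N by fact
  have spM: "space M = topspace X" and spN: "space N = topspace X"
    using sets_eq_imp_space_eq[OF M(2)] sets_eq_imp_space_eq[OF N(2)]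
    by (simp_all add: space_borel_space)
  obtain C V where C: "closedin X C" "C \<subseteq> A" and V: "openin X V" "A \<subseteq> V"
    and MC: "measure M (V - C) < \<epsilon> / 2"
    using closed_open_approximation[OF M X(2) _ \<open>0 < \<epsilon> / 2\<close>] A M(2) by metis
  obtain D U where D: "closedin X D" "D \<subseteq> A" and U: "openin X U" "A \<subseteq> U"
    and NU: "measure N (U - D) < \<epsilon> / 2"
    using closed_open_approximation[OF N X(2) _ \<open>0 < \<epsilon> / 2\<close>] A N(2) by metis
  have sets: "C \<in> sets (borel_space X)" "V \<in> sets (borel_space X)"
    "D \<in> sets (borel_space X)" "U \<in> sets (borel_space X)"
    using C D U V by (auto intro: closedin_sets_borel_space openin_sets_borel_space)
  have disj: "disjnt (topspace X - U) C"
    using C U by (auto simp: disjnt_def)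
  obtain f where f: "continuous_map X (top_of_set {0..1::real}) f"
    and f0: "f ` (topspace X - U) \<subseteq> {0}" and f1: "f ` C \<subseteq> {1}"
    by (rule Urysohn_lemma[OF metrizable_imp_normal_space[OF X(2)] _ C(1) disj, of 0 1])
      (use U in auto)
  have cont: "continuous_map X euclideanreal f" and f01: "\<And>x. x \<in> topspace X \<Longrightarrow> f x \<in> {0..1}"
    using f by (auto simp: continuous_map_in_subtopology)
  have "C \<subseteq> topspace X" using closedin_subset[OF C(1)] .
  have "measure M A \<le> measure M (C \<union> (V - C))"
    using V sets M(2) by (intro M.finite_measure_mono) auto
  also have "\<dots> \<le> measure M C + measure M (V - C)"
    using sets M(2) by (intro measure_Un_le) auto
  also have "measure M C = (\<integral>x. indicator C x \<partial>M)"
    using sets(1) M(2) \<open>C \<subseteq> topspace X\<close> spM by (simp add: Int_absorb2)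
  also have "\<dots> \<le> (\<integral>x. f x \<partial>M)"
    using sets(1) M(2) f1 f01 spM
    by (intro integral_mono integrable_continuous_compact[OF M X(1) cont]
        integrable_real_indicator)
      (auto simp: M.emeasure_finite less_top[symmetric] split: split_indicator)
  also have "\<dots> \<le> (\<integral>x. f x \<partial>N)"
    using f01 by (intro le cont) auto
  also have "\<dots> \<le> (\<integral>x. indicator U x \<partial>N)"
    using sets(4) N(2) f0 f01 spN
    by (intro integral_mono integrable_continuous_compact[OF N X(1) cont]
        integrable_real_indicator)
      (auto simp: N.emeasure_finite less_top[symmetric] split: split_indicator)
  also have "\<dots> = measure N U"
    using sets(4) N(2) openin_subset[OF U(1)] spN by (simp add: Int_absorb2)
  also have "\<dots> \<le> measure N (A \<union> (U - D))"
    using D(2) A sets N(2) by (intro N.finite_measure_mono) auto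
  also have "\<dots> \<le> measure N A + measure N (U - D)"
    using A sets N(2) by (intro measure_Un_le) auto
  finally show "measure M A \<le> measure N A + \<epsilon>"
    using MC NU by linarith
qed

section \<open>Averages along sofic maps bound the pressure\<close>

lemma sofic_maps_iff:
  assumes "finite F" "F \<noteq> {}"
  shows "\<phi> \<in> sofic_maps X \<alpha> \<rho> F \<delta> d \<sigma> \<longleftrightarrow>
    \<phi> \<in> {1..d} \<rightarrow>\<^sub>E topspace X \<and> (\<forall>s\<in>F. rho_2 \<rho> d (\<alpha> s \<circ> \<phi>) (\<phi> \<circ> \<sigma> s) < \<delta>)"
  using assms by (simp add: sofic_maps_def)

lemma sofic_maps_mono:
  assumes "finite F'" "F \<noteq> {}" "F \<subseteq> F'" "\<delta>' \<le> \<delta>"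
  shows "sofic_maps X \<alpha> \<rho> F' \<delta>' d \<sigma> \<subseteq> sofic_maps X \<alpha> \<rho> F \<delta> d \<sigma>"
proof -
  have F: "finite F" "F' \<noteq> {}" using assms finite_subset by auto
  show ?thesis
  proof
    fix \<phi> assume "\<phi> \<in> sofic_maps X \<alpha> \<rho> F' \<delta>' d \<sigma>"
    then show "\<phi> \<in> sofic_maps X \<alpha> \<rho> F \<delta> d \<sigma>"
      unfolding sofic_maps_iff[OF assms(1) F(2)] sofic_maps_iff[OF F(1) assms(2)]
      using assms(3,4) by (meson less_le_trans subsetD)
  qed
qed

lemma sofic_partition_sum_le:
  assumes sub: "sofic_maps X \<alpha> \<rho> F' \<delta>' d \<sigma> \<subseteq> sofic_maps X \<alpha> \<rho> F \<delta> d \<sigma>"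
    and le: "\<And>\<phi>. \<phi> \<in> sofic_maps X \<alpha> \<rho> F' \<delta>' d \<sigma> \<Longrightarrow> (\<Sum>a=1..d. f (\<phi> a)) \<le> r"
  shows "sofic_partition_sum f X \<alpha> \<rho> \<epsilon> F' \<delta>' d \<sigma> \<le>
    ennreal (exp r) * sofic_partition_sum (\<lambda>_. 0) X \<alpha> \<rho> \<epsilon> F \<delta> d \<sigma>"
  unfolding sofic_partition_sum_def[of f]
proof (rule SUP_least)
  fix \<E> assume "\<E> \<in> {\<E>. \<E> \<subseteq> sofic_maps X \<alpha> \<rho> F' \<delta>' d \<sigma> \<and> separated (rho_inf \<rho> d) \<epsilon> \<E>}"
  then have \<E>: "\<E> \<subseteq> sofic_maps X \<alpha> \<rho> F' \<delta>' d \<sigma>" "separated (rho_inf \<rho> d) \<epsilon> \<E>" by auto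
  have "(\<Sum>\<phi>\<in>\<E>. ennreal (exp (\<Sum>a=1..d. f (\<phi> a)))) \<le>
      (\<Sum>\<phi>\<in>\<E>. ennreal (exp r) * ennreal (exp (\<Sum>a=1..d. 0)))"
    using \<E>(1) le by (intro sum_mono) (auto intro!: ennreal_leI)
  also have "\<dots> = ennreal (exp r) * (\<Sum>\<phi>\<in>\<E>. ennreal (exp (\<Sum>a=1..d. 0)))"
    by (rule sum_distrib_left[symmetric])
  also have "(\<Sum>\<phi>\<in>\<E>. ennreal (exp (\<Sum>a=1..d. 0))) \<le>
      sofic_partition_sum (\<lambda>_. 0) X \<alpha> \<rho> \<epsilon> F \<delta> d \<sigma>"
    unfolding sofic_partition_sum_def
    by (rule SUP_upper) (use \<E> subset_trans[OF \<E>(1) sub] in simp)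
  finally show "(\<Sum>\<phi>\<in>\<E>. ennreal (exp (\<Sum>a=1..d. f (\<phi> a)))) \<le>
      ennreal (exp r) * sofic_partition_sum (\<lambda>_. 0) X \<alpha> \<rho> \<epsilon> F \<delta> d \<sigma>"
    by (simp add: mult_left_mono)
qed

lemma ln_extended_mono: "x \<le> y \<Longrightarrow> ln_extended x \<le> ln_extended y"
  by (cases x; cases y) (auto simp: ln_extended_def top_unique)

lemma ln_extended_exp_mult: "ln_extended (ennreal (exp r) * x) = ereal r + ln_extended x"
proof (cases x)
  case (real y)
  then have "ennreal (exp r) * x = ennreal (exp r * y)" by (simp add: ennreal_mult)
  with real show ?thesis
    by (cases "y = 0") (auto simp: ln_extended_def ln_mult)
qed (simp add: ln_extended_def ennreal_mult_eq_top_iff)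

text \<open>The averages are the integrals of \<open>f\<close> against the empirical distributions of the sofic maps
  \<open>\<phi>\<close>, which become invariant in the limit. For continuous \<open>f\<close> the condition thus plays the role
  of \<open>\<integral>f dM \<le> c\<close> for the invariant measures \<open>M\<close> that sofic maps approximate.\<close>

definition sofic_average_le ::
  "('g, 'm) monoid_scheme \<Rightarrow> 'a topology \<Rightarrow> ('g \<Rightarrow> 'a \<Rightarrow> 'a) \<Rightarrow> ('a \<Rightarrow> 'a \<Rightarrow> real) \<Rightarrow>
    (nat \<Rightarrow> nat) \<Rightarrow> (nat \<Rightarrow> 'g \<Rightarrow> nat \<Rightarrow> nat) \<Rightarrow> ('a \<Rightarrow> real) \<Rightarrow> real \<Rightarrow> bool"
  where "sofic_average_le G X \<alpha> \<rho> d \<sigma> f c \<longleftrightarrow>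
    (\<forall>\<eta>>0. \<exists>F \<delta>. F \<noteq> {} \<and> finite F \<and> F \<subseteq> carrier G \<and> 0 < \<delta> \<and>
      (\<forall>i. \<forall>\<phi> \<in> sofic_maps X \<alpha> \<rho> F \<delta> (d i) (\<sigma> i).
        (\<Sum>a=1..d i. f (\<phi> a)) \<le> real (d i) * (c + \<eta>)))"

lemma sofic_average_leE:
  assumes "sofic_average_le G X \<alpha> \<rho> d \<sigma> f c" "0 < \<eta>"
  obtains F \<delta> where "F \<noteq> {}" "finite F" "F \<subseteq> carrier G" "0 < \<delta>"
    "\<forall>i. \<forall>\<phi> \<in> sofic_maps X \<alpha> \<rho> F \<delta> (d i) (\<sigma> i).
      (\<Sum>a=1..d i. f (\<phi> a)) \<le> real (d i) * (c + \<eta>)"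
  using assms(1)[unfolded sofic_average_le_def, rule_format, OF assms(2)]
  by (elim exE conjE) (rule that)

lemma sofic_average_le_mult:
  assumes "sofic_average_le G X \<alpha> \<rho> d \<sigma> f c" "0 < t"
  shows "sofic_average_le G X \<alpha> \<rho> d \<sigma> (\<lambda>x. t * f x) (t * c)"
  unfolding sofic_average_le_def
proof (intro allI impI)
  fix \<eta> :: real assume "0 < \<eta>"
  then have "0 < \<eta> / t" using assms(2) by simp
  from sofic_average_leE[OF assms(1) this]
  obtain F \<delta> where F: "F \<noteq> {}" "finite F" "F \<subseteq> carrier G" "0 < \<delta>"
    and le: "\<forall>i. \<forall>\<phi> \<in> sofic_maps X \<alpha> \<rho> F \<delta> (d i) (\<sigma> i).
      (\<Sum>a=1..d i. f (\<phi> a)) \<le> real (d i) * (c + \<eta> / t)" .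
  have "(\<Sum>a=1..d i. t * f (\<phi> a)) \<le> real (d i) * (t * c + \<eta>)"
    if "\<phi> \<in> sofic_maps X \<alpha> \<rho> F \<delta> (d i) (\<sigma> i)" for i \<phi>
  proof -
    have "t * (\<Sum>a=1..d i. f (\<phi> a)) \<le> t * (real (d i) * (c + \<eta> / t))"
      using le[rule_format, OF that] assms(2) by (intro mult_left_mono) auto
    then show ?thesis
      using assms(2) by (simp add: sum_distrib_left algebra_simps)
  qed
  with F show "\<exists>F \<delta>. F \<noteq> {} \<and> finite F \<and> F \<subseteq> carrier G \<and> 0 < \<delta> \<and>
      (\<forall>i. \<forall>\<phi> \<in> sofic_maps X \<alpha> \<rho> F \<delta> (d i) (\<sigma> i).
        (\<Sum>a=1..d i. t * f (\<phi> a)) \<le> real (d i) * (t * c + \<eta>))"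
    by (intro exI[of _ F] exI[of _ \<delta>] conjI allI ballI)
qed

lemma limsup_sofic_partition_sum_le:
  assumes d: "filterlim d at_top sequentially"
    and sub: "\<And>i. sofic_maps X \<alpha> \<rho> F' \<delta>' (d i) (\<sigma> i) \<subseteq> sofic_maps X \<alpha> \<rho> F \<delta> (d i) (\<sigma> i)"
    and le: "\<And>i \<phi>. \<phi> \<in> sofic_maps X \<alpha> \<rho> F' \<delta>' (d i) (\<sigma> i) \<Longrightarrow>
      (\<Sum>a=1..d i. f (\<phi> a)) \<le> real (d i) * c"
  shows "limsup (\<lambda>i. ereal (1 / real (d i)) *
      ln_extended (sofic_partition_sum f X \<alpha> \<rho> \<epsilon> F' \<delta>' (d i) (\<sigma> i))) \<le>
    ereal c + limsup (\<lambda>i. ereal (1 / real (d i)) *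
      ln_extended (sofic_partition_sum (\<lambda>_. 0) X \<alpha> \<rho> \<epsilon> F \<delta> (d i) (\<sigma> i)))"
    (is "limsup (\<lambda>i. _ i * ?L i) \<le> _ + limsup (\<lambda>i. _ i * ?Z i)")
proof -
  have "ereal (1 / real (d i)) * ?L i \<le> ereal c + ereal (1 / real (d i)) * ?Z i"
    if di: "1 \<le> d i" for i
  proof -
    have "?L i \<le> ln_extended (ennreal (exp (real (d i) * c)) *
        sofic_partition_sum (\<lambda>_. 0) X \<alpha> \<rho> \<epsilon> F \<delta> (d i) (\<sigma> i))"
      by (intro ln_extended_mono sofic_partition_sum_le[OF sub] le)
    also have "\<dots> = ereal (real (d i) * c) + ?Z i"
      by (rule ln_extended_exp_mult)
    finally have "ereal (1 / real (d i)) * ?L i \<le>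
        ereal (1 / real (d i)) * (ereal (real (d i) * c) + ?Z i)"
      by (rule ereal_mult_left_mono) simp
    also have "\<dots> = ereal c + ereal (1 / real (d i)) * ?Z i"
      using di by (cases "?Z i") (simp_all add: field_simps)
    finally show ?thesis .
  qed
  moreover have "\<forall>\<^sub>F i in sequentially. 1 \<le> d i"
    using d unfolding filterlim_at_top by blast
  ultimately have "limsup (\<lambda>i. ereal (1 / real (d i)) * ?L i) \<le>
      limsup (\<lambda>i. ereal c + ereal (1 / real (d i)) * ?Z i)"
    by (intro Limsup_mono) (rule eventually_mono)
  also have "\<dots> = ereal c + limsup (\<lambda>i. ereal (1 / real (d i)) * ?Z i)"
    by (rule Limsup_add_ereal_left) simp_all
  finally show ?thesis .
qed

text \<open>In the infima defining the entropy it suffices to consider pairs \<open>(F, \<delta>)\<close> refining the pair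
  \<open>(F\<^sub>0, \<delta>\<^sub>0)\<close> for which \<open>f\<close> has averages at most \<open>c + \<eta>\<close>, since refining only removes
  sofic maps.\<close>

lemma sofic_pressure_le:
  assumes f: "sofic_average_le G X \<alpha> \<rho> d \<sigma> f c"
    and d: "filterlim d at_top sequentially"
  shows "sofic_pressure G X \<alpha> \<rho> d \<sigma> f \<le> sofic_entropy G X \<alpha> \<rho> d \<sigma> + ereal c"
proof -
  define L where "L f \<epsilon> F \<delta> = limsup (\<lambda>i. ereal (1 / real (d i)) *
    ln_extended (sofic_partition_sum f X \<alpha> \<rho> \<epsilon> F \<delta> (d i) (\<sigma> i)))" for f \<epsilon> F \<delta>
  define \<F> where "\<F> = {F. F \<noteq> {} \<and> finite F \<and> F \<subseteq> carrier G}"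
  define P where "P f \<epsilon> = (INF F\<in>\<F>. INF \<delta>\<in>{0<..}. L f \<epsilon> F \<delta>)" for f \<epsilon>
  have pressure: "sofic_pressure G X \<alpha> \<rho> d \<sigma> f = (SUP \<epsilon>\<in>{0<..}. P f \<epsilon>)" for f
    unfolding sofic_pressure_def P_def L_def \<F>_def ..
  have le: "P f \<epsilon> \<le> sofic_entropy G X \<alpha> \<rho> d \<sigma> + ereal (c + \<eta>)"
    if \<epsilon>: "0 < \<epsilon>" and \<eta>: "0 < \<eta>" for \<epsilon> \<eta> :: real
  proof -
    from sofic_average_leE[OF f \<eta>]
    obtain F\<^sub>0 \<delta>\<^sub>0 where F\<^sub>0: "F\<^sub>0 \<noteq> {}" "finite F\<^sub>0" "F\<^sub>0 \<subseteq> carrier G" "0 < \<delta>\<^sub>0"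
      and le: "\<forall>i. \<forall>\<phi> \<in> sofic_maps X \<alpha> \<rho> F\<^sub>0 \<delta>\<^sub>0 (d i) (\<sigma> i).
        (\<Sum>a=1..d i. f (\<phi> a)) \<le> real (d i) * (c + \<eta>)" .
    have "P f \<epsilon> \<le> ereal (c + \<eta>) + L (\<lambda>_. 0) \<epsilon> F \<delta>" if F: "F \<in> \<F>" and \<delta>: "0 < \<delta>" for F \<delta>
    proof -
      have sub: "sofic_maps X \<alpha> \<rho> (F \<union> F\<^sub>0) (min \<delta> \<delta>\<^sub>0) d \<sigma> \<subseteq> sofic_maps X \<alpha> \<rho> F \<delta> d \<sigma>"
        "sofic_maps X \<alpha> \<rho> (F \<union> F\<^sub>0) (min \<delta> \<delta>\<^sub>0) d \<sigma> \<subseteq> sofic_maps X \<alpha> \<rho> F\<^sub>0 \<delta>\<^sub>0 d \<sigma>" for d \<sigma>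
        using F F\<^sub>0 by (intro sofic_maps_mono; simp add: \<F>_def)+
      have "P f \<epsilon> \<le> (INF \<delta>\<in>{0<..}. L f \<epsilon> (F \<union> F\<^sub>0) \<delta>)"
        unfolding P_def by (rule INF_lower) (use F F\<^sub>0 in \<open>simp add: \<F>_def\<close>)
      also have "\<dots> \<le> L f \<epsilon> (F \<union> F\<^sub>0) (min \<delta> \<delta>\<^sub>0)"
        by (rule INF_lower) (use \<delta> F\<^sub>0 in simp)
      also have "\<dots> \<le> ereal (c + \<eta>) + L (\<lambda>_. 0) \<epsilon> F \<delta>"
        unfolding L_def by (intro limsup_sofic_partition_sum_le d sub(1)
            le[rule_format] subsetD[OF sub(2)])
      finally show ?thesis .
    qed
    then have "P f \<epsilon> - ereal (c + \<eta>) \<le> L (\<lambda>_. 0) \<epsilon> F \<delta>" if "F \<in> \<F>" "0 < \<delta>" for F \<delta>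
      using that by (simp add: ereal_minus_le add.commute)
    then have "P f \<epsilon> - ereal (c + \<eta>) \<le> P (\<lambda>_. 0) \<epsilon>"
      unfolding P_def[of "\<lambda>_. 0"] by (intro INF_greatest) simp
    also have "\<dots> \<le> sofic_entropy G X \<alpha> \<rho> d \<sigma>"
      unfolding sofic_entropy_def pressure by (rule SUP_upper) (use \<epsilon> in simp)
    finally show ?thesis
      by (simp add: ereal_minus_le)
  qed
  show ?thesis
    unfolding pressure
  proof (rule SUP_least)
    fix \<epsilon> :: real assume "\<epsilon> \<in> {0<..}"
    then have "P f \<epsilon> \<le> (sofic_entropy G X \<alpha> \<rho> d \<sigma> + ereal c) + ereal \<eta>" if "0 < \<eta>" for \<eta>
      using le[of \<epsilon> \<eta>] that by (simp add: add.assoc)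
    then show "P f \<epsilon> \<le> sofic_entropy G X \<alpha> \<rho> d \<sigma> + ereal c"
      by (rule ereal_le_epsilon2)
  qed
qed

lemma signed_integral_mult: "signed_integral X \<mu> (\<lambda>x. t * f x) = t * signed_integral X \<mu> f"
  by (simp add: signed_integral_def right_diff_distrib)

section \<open>Integral bounds from pressure bounds\<close>

text \<open>The pressure of \<open>t f\<close> is at most \<open>t c\<close> plus a constant. If the integral of \<open>f\<close> were
  larger than \<open>c\<close>, then that of \<open>t f\<close> would exceed \<open>t c\<close> by an amount growing linearly in \<open>t\<close>.\<close>

lemma signed_integral_le:
  assumes d: "filterlim d at_top sequentially"
    and fin: "sofic_entropy G X \<alpha> \<rho> d \<sigma> \<noteq> \<infinity>"
    and bound: "\<And>f. continuous_map X euclideanreal f \<Longrightarrow>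
      ereal (signed_integral X \<mu> f) \<le> sofic_pressure G X \<alpha> \<rho> d \<sigma> f"
    and f: "continuous_map X euclideanreal f" "sofic_average_le G X \<alpha> \<rho> d \<sigma> f c"
  shows "signed_integral X \<mu> f \<le> c"
proof (rule ccontr)
  assume "\<not> ?thesis"
  then have gap: "0 < signed_integral X \<mu> f - c" by simp
  obtain h :: real where h: "sofic_entropy G X \<alpha> \<rho> d \<sigma> \<le> ereal h"
    using fin by (cases "sofic_entropy G X \<alpha> \<rho> d \<sigma>") auto
  have le: "t * (signed_integral X \<mu> f - c) \<le> h" if "0 < t" for t
  proof -
    have "ereal (t * signed_integral X \<mu> f) \<le> sofic_pressure G X \<alpha> \<rho> d \<sigma> (\<lambda>x. t * f x)"
      unfolding signed_integral_mult[symmetric]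
      by (intro bound continuous_map_real_mult f(1)) simp
    also have "\<dots> \<le> sofic_entropy G X \<alpha> \<rho> d \<sigma> + ereal (t * c)"
      by (intro sofic_pressure_le sofic_average_le_mult f(2) d that)
    also have "\<dots> \<le> ereal h + ereal (t * c)"
      by (intro add_right_mono h)
    finally show ?thesis by (simp add: algebra_simps)
  qed
  \<comment> \<open>For this \<open>t\<close> the left-hand side is \<open>\<bar>h\<bar> + 1\<close>.\<close>
  have "(\<bar>h\<bar> + 1) / (signed_integral X \<mu> f - c) * (signed_integral X \<mu> f - c) \<le> h"
    using gap by (intro le) (simp add: field_simps)
  then show False using gap by simp
qed

lemma sofic_average_le_pointwise:
  assumes "group G" and le: "\<And>x. x \<in> topspace X \<Longrightarrow> f x \<le> c"
  shows "sofic_average_le G X \<alpha> \<rho> d \<sigma> f c"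
  unfolding sofic_average_le_def
proof (intro allI impI exI conjI ballI)
  fix \<eta> :: real and i \<phi>
  assume \<eta>: "0 < \<eta>" and \<phi>: "\<phi> \<in> sofic_maps X \<alpha> \<rho> {\<one>\<^bsub>G\<^esub>} 1 (d i) (\<sigma> i)"
  have "f (\<phi> a) \<le> c + \<eta>" if "a \<in> {1..d i}" for a
  proof -
    have "\<phi> a \<in> topspace X" using \<phi> that by (auto simp: sofic_maps_iff)
    then show ?thesis using le \<eta> by (smt (verit))
  qed
  then have "(\<Sum>a=1..d i. f (\<phi> a)) \<le> (\<Sum>a=1..d i. c + \<eta>)" by (rule sum_mono)
  then show "(\<Sum>a=1..d i. f (\<phi> a)) \<le> real (d i) * (c + \<eta>)" by simp
qed (use \<open>group G\<close> in \<open>auto intro: group.is_monoid monoid.one_closed\<close>)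

text \<open>Uniform continuity in a form that can be summed: points closer than the modulus for \<open>\<eta>\<close>
  contribute \<open>\<eta>\<close>, and for the others the quadratic term exceeds the oscillation of \<open>g\<close>. The
  square matches the mean-square distance \<open>rho_2\<close>, so that averaging is direct.\<close>

lemma continuous_map_quadratic_modulus:
  assumes X: "compact_space X" "compatible_metric X \<rho>"
    and g: "continuous_map X euclideanreal g" and "0 < \<eta>"
  obtains K where "0 \<le> K"
    "\<And>x y. x \<in> topspace X \<Longrightarrow> y \<in> topspace X \<Longrightarrow> \<bar>g x - g y\<bar> \<le> \<eta> + K * (\<rho> x y)\<^sup>2"
proof -
  interpret Metric_space "topspace X" \<rho>
    using X(2) by (simp add: compatible_metric_def)
  have top: "mtopology = X"
    using X(2) by (simp add: compatible_metric_def)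
  have "uniformly_continuous_map (metric (topspace X, \<rho>)) euclidean_metric g"
    using X(1) g by (intro continuous_imp_uniformly_continuous_map) (simp add: top)
  then obtain r where "0 < r" and
    r: "\<And>x y. x \<in> topspace X \<Longrightarrow> y \<in> topspace X \<Longrightarrow> \<rho> y x < r \<Longrightarrow> dist (g y) (g x) < \<eta>"
    using \<open>0 < \<eta>\<close> unfolding uniformly_continuous_map_def by auto
  obtain B where B: "0 < B" "\<And>x. x \<in> topspace X \<Longrightarrow> \<bar>g x\<bar> \<le> B"
    using bounded_continuous_compact[OF X(1) g] by blast
  show thesis
  proof (rule that[of "2 * B / r\<^sup>2"])
    show "0 \<le> 2 * B / r\<^sup>2" using B(1) by simp
    fix x y assume xy: "x \<in> topspace X" "y \<in> topspace X"
    show "\<bar>g x - g y\<bar> \<le> \<eta> + 2 * B / r\<^sup>2 * (\<rho> x y)\<^sup>2"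
    proof (cases "\<rho> x y < r")
      case True
      then have "\<bar>g x - g y\<bar> < \<eta>" using r[OF xy(2,1)] by (simp add: dist_real_def)
      moreover have "0 \<le> 2 * B / r\<^sup>2 * (\<rho> x y)\<^sup>2" using B(1) by simp
      ultimately show ?thesis by linarith
    next
      case False
      then have "r\<^sup>2 \<le> (\<rho> x y)\<^sup>2" using \<open>0 < r\<close> by (intro power_mono) auto
      then have "2 * B / r\<^sup>2 * r\<^sup>2 \<le> 2 * B / r\<^sup>2 * (\<rho> x y)\<^sup>2"
        using B(1) by (intro mult_left_mono) auto
      then have "2 * B \<le> 2 * B / r\<^sup>2 * (\<rho> x y)\<^sup>2" using \<open>0 < r\<close> by simp
      then show ?thesis using B(2)[OF xy(1)] B(2)[OF xy(2)] \<open>0 < \<eta>\<close> by linarith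
    qed
  qed
qed

text \<open>Reindexing by the permutation \<open>\<sigma> s\<close> replaces \<open>g (\<phi> a)\<close> by \<open>g (\<phi> (\<sigma> s a))\<close> in the sum. The
  quadratic modulus then bounds the average by \<open>\<eta> / 2 + K \<delta>\<^sup>2\<close>, as \<open>rho_2\<close> is below \<open>\<delta>\<close>.\<close>

lemma sofic_average_le_coboundary:
  assumes X: "compact_space X" "compatible_metric X \<rho>"
    and \<sigma>: "\<And>i. \<sigma> i s \<in> carrier (sym_group (d i))"
    and s: "s \<in> carrier G" "continuous_map X X (\<alpha> s)"
    and g: "continuous_map X euclideanreal g"
  shows "sofic_average_le G X \<alpha> \<rho> d \<sigma> (\<lambda>x. g (\<alpha> s x) - g x) 0"
  unfolding sofic_average_le_def
proof (intro allI impI)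
  fix \<eta> :: real assume "0 < \<eta>"
  then have "0 < \<eta> / 2" by simp
  then obtain K where K: "0 \<le> K"
    "\<And>x y. x \<in> topspace X \<Longrightarrow> y \<in> topspace X \<Longrightarrow> \<bar>g x - g y\<bar> \<le> \<eta> / 2 + K * (\<rho> x y)\<^sup>2"
    using continuous_map_quadratic_modulus[OF X g] by blast
  \<comment> \<open>The summand \<open>1\<close> only keeps the denominator positive when \<open>K = 0\<close>.\<close>
  define \<delta> where "\<delta> = sqrt (\<eta> / (2 * (K + 1)))"
  have \<delta>: "0 < \<delta>" using \<open>0 < \<eta>\<close> K(1) by (simp add: \<delta>_def)
  have "\<delta>\<^sup>2 = \<eta> / (2 * (K + 1))"
    using \<open>0 < \<eta>\<close> K(1) by (simp add: \<delta>_def)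
  then have "(K + 1) * \<delta>\<^sup>2 = \<eta> / 2"
    using K(1) by (simp add: field_simps)
  moreover have "K * \<delta>\<^sup>2 \<le> (K + 1) * \<delta>\<^sup>2"
    by (intro mult_right_mono) auto
  ultimately have K\<delta>: "K * \<delta>\<^sup>2 \<le> \<eta> / 2" by simp
  have "(\<Sum>a=1..d i. g (\<alpha> s (\<phi> a)) - g (\<phi> a)) \<le> real (d i) * (0 + \<eta>)"
    if \<phi>: "\<phi> \<in> sofic_maps X \<alpha> \<rho> {s} \<delta> (d i) (\<sigma> i)" for i \<phi>
  proof (cases "d i = 0")
    case False
    let ?\<rho> = "\<lambda>a. (\<rho> (\<alpha> s (\<phi> a)) (\<phi> (\<sigma> i s a)))\<^sup>2"
    have perm: "\<sigma> i s permutes {1..d i}"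
      using \<sigma> by (simp add: sym_group_carrier)
    have \<phi>X: "\<phi> a \<in> topspace X" if "a \<in> {1..d i}" for a
      using \<phi> that by (auto simp: sofic_maps_iff)
    have \<phi>\<sigma>X: "\<phi> (\<sigma> i s a) \<in> topspace X" if "a \<in> {1..d i}" for a
      using \<phi>X permutes_in_image[OF perm, of a] that by blast
    have \<alpha>X: "\<alpha> s x \<in> topspace X" if "x \<in> topspace X" for x
      using s(2) that by (auto simp: continuous_map_def)
    have "rho_2 \<rho> (d i) (\<alpha> s \<circ> \<phi>) (\<phi> \<circ> \<sigma> i s) < \<delta>"
      using \<phi> by (simp add: sofic_maps_iff)
    then have "(rho_2 \<rho> (d i) (\<alpha> s \<circ> \<phi>) (\<phi> \<circ> \<sigma> i s))\<^sup>2 \<le> \<delta>\<^sup>2"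
      by (intro power_mono)
        (auto simp: rho_2_def intro!: real_sqrt_ge_zero divide_nonneg_nonneg sum_nonneg)
    then have "1 / real (d i) * (\<Sum>a=1..d i. ?\<rho> a) \<le> \<delta>\<^sup>2"
      by (simp add: rho_2_def sum_nonneg)
    then have sum_\<rho>: "(\<Sum>a=1..d i. ?\<rho> a) \<le> real (d i) * \<delta>\<^sup>2"
      using False by (simp add: field_simps)
    have "(\<Sum>a=1..d i. g (\<phi> a)) = (\<Sum>a=1..d i. g (\<phi> (\<sigma> i s a)))"
      by (rule sum.permute[OF perm, unfolded comp_def])
    then have "(\<Sum>a=1..d i. g (\<alpha> s (\<phi> a)) - g (\<phi> a)) =
        (\<Sum>a=1..d i. g (\<alpha> s (\<phi> a)) - g (\<phi> (\<sigma> i s a)))"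
      by (simp add: sum_subtractf)
    also have "\<dots> \<le> (\<Sum>a=1..d i. \<eta> / 2 + K * ?\<rho> a)"
    proof (rule sum_mono)
      fix a assume "a \<in> {1..d i}"
      then show "g (\<alpha> s (\<phi> a)) - g (\<phi> (\<sigma> i s a)) \<le> \<eta> / 2 + K * ?\<rho> a"
        using K(2)[OF \<alpha>X[OF \<phi>X] \<phi>\<sigma>X, of a a] by linarith
    qed
    also have "\<dots> = real (d i) * (\<eta> / 2) + K * (\<Sum>a=1..d i. ?\<rho> a)"
      by (simp add: sum.distrib sum_distrib_left)
    also have "\<dots> \<le> real (d i) * (\<eta> / 2) + K * (real (d i) * \<delta>\<^sup>2)"
      using sum_\<rho> K(1) by (intro add_left_mono mult_left_mono)
    also have "\<dots> = real (d i) * (\<eta> / 2 + K * \<delta>\<^sup>2)"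
      by (simp add: algebra_simps)
    also have "\<dots> \<le> real (d i) * (0 + \<eta>)"
      using K\<delta> by (intro mult_left_mono) auto
    finally show ?thesis .
  qed simp
  then show "\<exists>F \<delta>. F \<noteq> {} \<and> finite F \<and> F \<subseteq> carrier G \<and> 0 < \<delta> \<and>
      (\<forall>i. \<forall>\<phi> \<in> sofic_maps X \<alpha> \<rho> F \<delta> (d i) (\<sigma> i).
        (\<Sum>a=1..d i. g (\<alpha> s (\<phi> a)) - g (\<phi> a)) \<le> real (d i) * (0 + \<eta>))"
    using \<delta> s(1) by (intro exI[of _ "{s}"] exI[of _ \<delta>]) auto
qed

section \<open>From integrals to an invariant measure\<close>

lemma metrizable_space_compatible: "compatible_metric X \<rho> \<Longrightarrow> metrizable_space X"
  unfolding compatible_metric_def metrizable_space_def by metis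

text \<open>Nonnegativity on continuous functions compares the two parts of the Jordan decomposition on
  every Borel set.\<close>

lemma signed_measure_nonneg:
  assumes \<mu>: "signed_measure X \<mu>" and X: "compact_space X" "metrizable_space X"
    and nonneg: "\<And>f. continuous_map X euclideanreal f \<Longrightarrow>
      (\<And>x. x \<in> topspace X \<Longrightarrow> 0 \<le> f x) \<Longrightarrow> 0 \<le> signed_integral X \<mu> f"
    and A: "A \<in> sets (borel_space X)"
  shows "0 \<le> \<mu> A"
proof -
  have "measure (positive_part X (\<lambda>A. - \<mu> A)) A \<le> measure (positive_part X \<mu>) A"
  proof (rule measure_le_if_integral_continuous_le[OF _ _ _ _ X])
    fix f assume "continuous_map X euclideanreal f" "\<And>x. x \<in> topspace X \<Longrightarrow> 0 \<le> f x"
    from nonneg[OF this]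
    show "(\<integral>x. f x \<partial>positive_part X (\<lambda>A. - \<mu> A)) \<le> (\<integral>x. f x \<partial>positive_part X \<mu>)"
      by (simp add: signed_integral_def)
  qed (use A in \<open>simp_all add: finite_measure_positive_part signed_measure_uminus \<mu>\<close>)
  then show ?thesis
    using Jordan_decomposition[OF \<mu> A] by simp
qed

lemma measure_positive_part_nonneg:
  assumes \<mu>: "signed_measure X \<mu>" and A: "A \<in> sets (borel_space X)"
    and nonneg: "\<And>A. A \<in> sets (borel_space X) \<Longrightarrow> 0 \<le> \<mu> A"
  shows "measure (positive_part X \<mu>) A = \<mu> A"
proof (rule antisym)
  show "measure (positive_part X \<mu>) A \<le> \<mu> A"
  proof (rule measure_positive_part_le[OF \<mu> A])
    fix B assume B: "B \<in> sets (borel_space X)" "B \<subseteq> A"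
    then show "\<mu> B \<le> \<mu> A"
      using signed_measure_Diff[OF \<mu> A B] nonneg[of "A - B"] A by auto
  qed
qed (rule measure_positive_part_ge[OF \<mu> A])

lemma signed_integral_nonneg_measure:
  assumes \<mu>: "signed_measure X \<mu>"
    and nonneg: "\<And>A. A \<in> sets (borel_space X) \<Longrightarrow> 0 \<le> \<mu> A"
  shows "signed_integral X \<mu> f = (\<integral>x. f x \<partial>positive_part X \<mu>)"
proof -
  let ?N = "positive_part X (\<lambda>A. - \<mu> A)"
  interpret N: finite_measure ?N
    by (intro finite_measure_positive_part signed_measure_uminus \<mu>)
  have X: "topspace X \<in> sets (borel_space X)"
    using sets.top[of "borel_space X"] by (simp add: space_borel_space)
  have "measure ?N (space ?N) = 0"
    using Jordan_decomposition[OF \<mu> X] measure_positive_part_nonneg[OF \<mu> X nonneg] by simp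
  then have "AE x in ?N. f x = 0"
    by (intro AE_I[of _ _ "space ?N"]) (auto simp: N.emeasure_eq_measure X)
  then have "(\<integral>x. f x \<partial>?N) = 0"
    by (rule integral_eq_zero_AE)
  then show ?thesis by (simp add: signed_integral_def)
qed

text \<open>One inequality for all \<open>g\<close> is enough, because it may be applied to \<open>- g\<close>.\<close>

lemma distr_eq_if_integral_continuous_le:
  assumes M: "finite_measure M" "sets M = sets (borel_space X)"
    and X: "compact_space X" "metrizable_space X"
    and T: "continuous_map X X T"
    and le: "\<And>g. continuous_map X euclideanreal g \<Longrightarrow> (\<integral>x. g (T x) - g x \<partial>M) \<le> 0"
  shows "distr M M T = M"
proof -
  interpret finite_measure M by fact
  have T_meas: "T \<in> M \<rightarrow>\<^sub>M M"
    using continuous_map_measurable_borel_space[OF T] M(2) by (simp cong: measurable_cong_sets)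
  have D: "finite_measure (distr M M T)" "sets (distr M M T) = sets (borel_space X)"
    using T_meas M(2) by (auto intro: finite_measure_distr)
  have le': "(\<integral>x. g x \<partial>distr M M T) \<le> (\<integral>x. g x \<partial>M)" if g: "continuous_map X euclideanreal g" for g
  proof -
    have "integrable M (\<lambda>x. g (T x))" "integrable M g"
      using continuous_map_compose[OF T g] g
      by (auto intro!: integrable_continuous_compact[OF M X(1)] simp: comp_def)
    then have "(\<integral>x. g (T x) \<partial>M) \<le> (\<integral>x. g x \<partial>M)"
      using le[OF g] by simp
    moreover have "g \<in> borel_measurable M"
      using \<open>integrable M g\<close> by auto
    ultimately show ?thesis
      using T_meas by (simp add: integral_distr)
  qed
  have ge': "(\<integral>x. g x \<partial>M) \<le> (\<integral>x. g x \<partial>distr M M T)" if "continuous_map X euclideanreal g" for g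
    using le'[of "\<lambda>x. - g x"] that by (simp add: continuous_map_minus)
  interpret D: finite_measure "distr M M T" by (rule D)
  show ?thesis
  proof (rule measure_eqI)
    fix A assume "A \<in> sets (distr M M T)"
    then have A: "A \<in> sets (borel_space X)" using M(2) by simp
    have "measure (distr M M T) A = measure M A"
      by (intro antisym measure_le_if_integral_continuous_le[OF D M X _ A]
          measure_le_if_integral_continuous_le[OF M D X _ A] le' ge')
    then show "emeasure (distr M M T) A = emeasure M A"
      by (simp add: D.emeasure_eq_measure emeasure_eq_measure)
  qed simp
qed

theorem theorem6p2:
  fixes G :: "('g, 'm) monoid_scheme"
    and X :: "'a topology"
    and \<alpha> :: "'g \<Rightarrow> 'a \<Rightarrow> 'a"
    and \<rho> :: "'a \<Rightarrow> 'a \<Rightarrow> real"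
    and d :: "nat \<Rightarrow> nat"
    and \<sigma> :: "nat \<Rightarrow> 'g \<Rightarrow> nat \<Rightarrow> nat"
    and \<mu> :: "'a set \<Rightarrow> real"
  assumes "group G" and "countable (carrier G)"
    and "sofic_approximation G d \<sigma>"
    and "compact_space X" and "compatible_metric X \<rho>"
    and "continuous_action G X \<alpha>"
    and "sofic_entropy G X \<alpha> \<rho> d \<sigma> \<noteq> \<infinity>" and "sofic_entropy G X \<alpha> \<rho> d \<sigma> \<noteq> -\<infinity>"
    and "signed_measure X \<mu>"
    and "\<And>f :: 'a \<Rightarrow> real. continuous_map X euclideanreal f \<Longrightarrow>
      ereal (signed_integral X \<mu> f) \<le> sofic_pressure G X \<alpha> \<rho> d \<sigma> f"
  shows "\<exists>M \<in> invariant_measures G X \<alpha>. \<forall>A \<in> sets (borel_space X). \<mu> A = measure M A"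
proof -
  note \<mu> = \<open>signed_measure X \<mu>\<close>
  have X: "compact_space X" "metrizable_space X"
    using assms(4,5) metrizable_space_compatible by auto
  have d: "filterlim d at_top sequentially"
    and \<sigma>: "\<And>i s. s \<in> carrier G \<Longrightarrow> \<sigma> i s \<in> carrier (sym_group (d i))"
    using assms(3) by (auto simp: sofic_approximation_def)
  have integral_le: "signed_integral X \<mu> f \<le> c"
    if "continuous_map X euclideanreal f" "sofic_average_le G X \<alpha> \<rho> d \<sigma> f c" for f c
    using d assms(7,10) that by (rule signed_integral_le)
  have integral_le_pointwise: "signed_integral X \<mu> f \<le> c"
    if "continuous_map X euclideanreal f" "\<And>x. x \<in> topspace X \<Longrightarrow> f x \<le> c" for f c
    by (intro integral_le sofic_average_le_pointwise that \<open>group G\<close>)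
  have nonneg: "0 \<le> \<mu> A" if "A \<in> sets (borel_space X)" for A
  proof (rule signed_measure_nonneg[OF \<mu> X _ that])
    fix f assume f: "continuous_map X euclideanreal f" "\<And>x. x \<in> topspace X \<Longrightarrow> 0 \<le> f x"
    have "signed_integral X \<mu> (\<lambda>x. (-1) * f x) \<le> 0"
      using f by (intro integral_le_pointwise continuous_map_real_mult) auto
    then show "0 \<le> signed_integral X \<mu> f"
      by (simp only: signed_integral_mult)
  qed
  define M where "M = positive_part X \<mu>"
  have M: "finite_measure M" "sets M = sets (borel_space X)" "space M = topspace X"
    by (simp_all add: M_def finite_measure_positive_part \<mu>)
  interpret finite_measure M by (rule M)
  have \<mu>M: "\<mu> A = measure M A" if "A \<in> sets (borel_space X)" for A
    unfolding M_def using measure_positive_part_nonneg[OF \<mu> that nonneg] by simp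
  have int_M: "signed_integral X \<mu> f = (\<integral>x. f x \<partial>M)" for f
    unfolding M_def by (rule signed_integral_nonneg_measure[OF \<mu> nonneg])
  have "(\<integral>x. c \<partial>M) \<le> c" for c :: real
    unfolding int_M[symmetric] by (rule integral_le_pointwise) auto
  from this[of 1] this[of "-1"] have "measure M (space M) = 1"
    by simp
  then have "prob_space M"
    by (intro prob_spaceI) (simp add: emeasure_eq_measure)
  moreover have "distr M M (\<alpha> s) = M" if s: "s \<in> carrier G" for s
  proof (rule distr_eq_if_integral_continuous_le[OF M(1,2) X])
    show cont: "continuous_map X X (\<alpha> s)"
      using assms(6) s by (simp add: continuous_action_def)
    fix g :: "'a \<Rightarrow> real" assume g: "continuous_map X euclideanreal g"
    have "continuous_map X euclideanreal (\<lambda>x. g (\<alpha> s x) - g x)"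
      using continuous_map_compose[OF cont g] g
      by (intro continuous_map_diff) (simp_all add: comp_def)
    then show "(\<integral>x. g (\<alpha> s x) - g x \<partial>M) \<le> 0"
      unfolding int_M[symmetric]
      by (intro integral_le sofic_average_le_coboundary assms(4,5) \<sigma> s cont g)
  qed
  ultimately have "M \<in> invariant_measures G X \<alpha>"
    using M(2) by (simp add: invariant_measures_def)
  then show ?thesis
    using \<mu>M by blast
qed

end
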